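(* Let $p\ge 1$ be an integer, let $A$ be a fixed zero-diagonal representative of an $\mathrm{SBIBD}(v,k,\lambda)$, and let $$q=\begin{cases}1,& p=1,\\ \lambda(p-1)+2,& p\ge 2.\end{cases}$$ If $q\le k$, then every legal placement (with respect to $A$) using exactly $q$ distinct target nodes per object permits recovery after the failure of any set of at most $p$ nodes. If at most two nodes fail (and at most $p$), every lost object is directly recoverable. In general, for any set of at most $p$ failed nodes, all directly recoverable lost objects can be restored in the first round and every remaining lost object can be restored in the second round.
   Context: Symmetric design. For integers $1\le\lambda<k<v$, an $\mathrm{SBIBD}(v,k,\lambda)$ consists of $v$ points and $v$ blocks such that every block contains $k$ points, every point lies in $k$ blocks, and every two distinct points lie together in exactly $\lambda$ blocks. (Standard fact: any two distinct blocks of such a symmetric design also share exactly $\lambda$ points.) After independently labeling points and blocks by $0,1,\dots,v-1$, the incidence matrix $A=(A_{ij})\in\{0,1\}^{v\times v}$, with $A_{ij}=1$ iff point $i$ lies in block $j$, is called a representative of the SBIBD. It is zero-diagonal if $A_{ii}=0$ for all $i$. Coding model. There are $v$ nodes $0,\dots,v-1$. For a node $i$ let $\mathcal S_{\mathrm{tgt}}(i)=\{j:A_{ij}=1\}$ (admissible targets) and $\mathcal S_{\mathrm{src}}(i)=\{h:A_{hi}=1\}$ (sources); both have size $k$. There is a finite collection of data objects, each a binary word of one common length; $\oplus$ is componentwise addition over $\mathbb F_2$. Each object $x$ has exactly one primary copy, stored at its primary node $i$, and for the replica count $q\in\{0,\dots,k\}$ it selects a set $T_x\subseteq\mathcal S_{\mathrm{tgt}}(i)$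 of exactly $q$ distinct target nodes (chosen separately for each object) and sends one replica to each node in $T_x$. A placement is legal if at each node $j$ the replicas received at $j$ are partitioned into $k$-tuples, each containing exactly one replica from every primary node in $\mathcal S_{\mathrm{src}}(j)$ (the partition is part of the placement). For each such tuple, consisting of objects $x_1,\dots,x_k$, node $j$ stores one parity $P=x_1\oplus\cdots\oplus x_k$, which is said to encode $x_1,\dots,x_k$ (its encodees); the replicas are then discarded. Thus each object $x$ is an encodee of exactly one parity at each node of $T_x$, and of no other parity. Failures and recovery. Given a set $F$ of failed nodes, all other nodes are alive; an object is lost if its primary node is in $F$, a parity is lost if the node storing it is in $F$; objects and parities that are not lost are alive. A placement permits recovery from $F$ if the values of all lost objects are uniquely determined by the alive primary copies and the alive parities (the placement being known). A lost object $x$ is directly recoverable if some alive parity encoding $x$ has no other lost encodee. Recovery is organized in rounds: in the first round one may use only alive primary copies and alive parities, and first-round recovery means direct recovery; in the second round one may also use values recovered in the first round, i.e. an object is restored in the second round from an alive parity encoding it all of whose other encodees are alive or were restored in the first round. *)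

theory Defs
  imports
    "HOL-Library.Disjoint_Sets"
    "HOL-Library.Z2"
    "Jordan_Normal_Form.Matrix"
begin

section \<open>Symmetric designs and their incidence matrices\<close>

text \<open>Blocks are abstract objects with an incidence relation \<open>inc\<close> to the points, so that
  the design itself does not rule out repeated blocks.\<close>

definition sbibd ::
  "'pt set \<Rightarrow> 'bl set \<Rightarrow> ('pt \<times> 'bl) set \<Rightarrow> nat \<Rightarrow> nat \<Rightarrow> nat \<Rightarrow> bool" where
  "sbibd Pts Bls inc v k l \<longleftrightarrow>
     1 \<le> l \<and> l < k \<and> k < v \<and>
     finite Pts \<and> card Pts = v \<and> finite Bls \<and> card Bls = v \<and>
     (\<forall>b\<in>Bls. card {x \<in> Pts. (x, b) \<in> inc} = k) \<and>
     (\<forall>x\<in>Pts. card {b \<in> Bls. (x, b) \<in> inc} = k) \<and>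
     (\<forall>x\<in>Pts. \<forall>y\<in>Pts. x \<noteq> y \<longrightarrow>
        card {b \<in> Bls. (x, b) \<in> inc \<and> (y, b) \<in> inc} = l)"

definition representative ::
  "'pt set \<Rightarrow> 'bl set \<Rightarrow> ('pt \<times> 'bl) set \<Rightarrow> nat \<Rightarrow> nat mat \<Rightarrow> bool" where
  "representative Pts Bls inc v A \<longleftrightarrow>
     A \<in> carrier_mat v v \<and>
     (\<exists>pt bl. bij_betw pt {..<v} Pts \<and> bij_betw bl {..<v} Bls \<and>
        (\<forall>i<v. \<forall>j<v. A $$ (i, j) = (if (pt i, bl j) \<in> inc then 1 else 0)))"

definition zero_diagonal :: "nat mat \<Rightarrow> bool" where
  "zero_diagonal A \<longleftrightarrow> (\<forall>i < dim_row A. A $$ (i, i) = 0)"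

section \<open>Placements\<close>

definition S_tgt :: "nat mat \<Rightarrow> nat \<Rightarrow> nat set" where
  "S_tgt A i = {j. j < dim_col A \<and> A $$ (i, j) = 1}"

definition S_src :: "nat mat \<Rightarrow> nat \<Rightarrow> nat set" where
  "S_src A j = {h. h < dim_row A \<and> A $$ (h, j) = 1}"

text \<open>Since an object sends at most one replica to a given node, the replicas received at
  node \<open>j\<close> are identified with the objects having \<open>j\<close> among their targets. Hence
  \<open>tuples pl j\<close>, the partition of the replicas at \<open>j\<close>, is a set of sets of objects, and
  the parities stored at \<open>j\<close> correspond to the elements of \<open>tuples pl j\<close>.\<close>

record 'x placement =
  objects :: "'x set"
  primary :: "'x \<Rightarrow> nat"
  targets :: "'x \<Rightarrow> nat set"
  tuples  :: "nat \<Rightarrow> 'x set set"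

definition legal_placement :: "nat mat \<Rightarrow> nat \<Rightarrow> nat \<Rightarrow> nat \<Rightarrow> 'x placement \<Rightarrow> bool" where
  "legal_placement A v k q pl \<longleftrightarrow>
     finite (objects pl) \<and>
     (\<forall>x\<in>objects pl. primary pl x < v \<and>
        targets pl x \<subseteq> S_tgt A (primary pl x) \<and> card (targets pl x) = q) \<and>
     (\<forall>j<v. partition_on {x \<in> objects pl. j \<in> targets pl x} (tuples pl j) \<and>
        (\<forall>B\<in>tuples pl j. card B = k \<and>
           (\<forall>h\<in>S_src A j. \<exists>!x. x \<in> B \<and> primary pl x = h)))"

text \<open>The parity of the objects in \<open>B\<close> when object \<open>x\<close> has the value \<open>w x\<close>, a binary
  word of length \<open>n\<close>; the sum is taken in the two-element field.\<close>

definition parity :: "nat \<Rightarrow> ('x \<Rightarrow> bit vec) \<Rightarrow> 'x set \<Rightarrow> bit vec" where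
  "parity n w B = vec n (\<lambda>t. \<Sum>x\<in>B. w x $ t)"

section \<open>Failures and recovery\<close>

definition lost_objects :: "'x placement \<Rightarrow> nat set \<Rightarrow> 'x set" where
  "lost_objects pl F = {x \<in> objects pl. primary pl x \<in> F}"

definition alive_objects :: "'x placement \<Rightarrow> nat set \<Rightarrow> 'x set" where
  "alive_objects pl F = objects pl - lost_objects pl F"

text \<open>A parity is given by its node and its set of encodees.\<close>

definition alive_parities :: "nat \<Rightarrow> 'x placement \<Rightarrow> nat set \<Rightarrow> (nat \<times> 'x set) set" where
  "alive_parities v pl F = {(j, B). j < v \<and> j \<notin> F \<and> B \<in> tuples pl j}"

definition permits_recovery :: "nat \<Rightarrow> nat \<Rightarrow> 'x placement \<Rightarrow> nat set \<Rightarrow> bool" where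
  "permits_recovery v n pl F \<longleftrightarrow>
     (\<forall>w w'. (\<forall>x\<in>objects pl. w x \<in> carrier_vec n) \<longrightarrow>
             (\<forall>x\<in>objects pl. w' x \<in> carrier_vec n) \<longrightarrow>
             (\<forall>x\<in>alive_objects pl F. w x = w' x) \<longrightarrow>
             (\<forall>(j, B)\<in>alive_parities v pl F. parity n w B = parity n w' B) \<longrightarrow>
             (\<forall>x\<in>lost_objects pl F. w x = w' x))"

definition directly_recoverable :: "nat \<Rightarrow> 'x placement \<Rightarrow> nat set \<Rightarrow> 'x \<Rightarrow> bool" where
  "directly_recoverable v pl F x \<longleftrightarrow> x \<in> lost_objects pl F \<and>
     (\<exists>(j, B)\<in>alive_parities v pl F. x \<in> B \<and> \<not> (\<exists>y\<in>B. y \<noteq> x \<and> y \<in> lost_objects pl F))"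

definition first_round :: "nat \<Rightarrow> 'x placement \<Rightarrow> nat set \<Rightarrow> 'x \<Rightarrow> bool" where
  "first_round v pl F x \<longleftrightarrow> x \<in> lost_objects pl F \<and>
     (\<exists>(j, B)\<in>alive_parities v pl F. x \<in> B \<and> (\<forall>y\<in>B - {x}. y \<in> alive_objects pl F))"

definition second_round :: "nat \<Rightarrow> 'x placement \<Rightarrow> nat set \<Rightarrow> 'x \<Rightarrow> bool" where
  "second_round v pl F x \<longleftrightarrow> x \<in> lost_objects pl F \<and>
     (\<exists>(j, B)\<in>alive_parities v pl F. x \<in> B \<and>
        (\<forall>y\<in>B - {x}. y \<in> alive_objects pl F \<or> first_round v pl F y))"

end

(* Let x be lost, with primary node i, and let h range over the other failed nodes. An alive
   target j of x fails to restore x directly only if j is also a target of some h, and each h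
   accounts for exactly \<lambda> such j. Hence an object that is not directly recoverable forces i to have
   at least two failed private targets, i.e. targets of i and of no other failed node. Private
   targets of different nodes are disjoint. If a second round did not restore x either, every alive
   target of x would be shared with one of the m other failed nodes owning an object that is not
   directly recoverable; the private targets of these m nodes are not targets of x, so
   q <= \<lambda> m + (p - 2 m), which contradicts q = \<lambda> (p - 1) + 2. *)

theory Submission
  imports Defs
begin

section \<open>Common targets as blocks through two points\<close>

lemma card_common_targets:
  assumes D: "sbibd Pts Bls inc v k l" and R: "representative Pts Bls inc v A"
    and "i < v" "h < v" "i \<noteq> h"
  shows "card (S_tgt A i \<inter> S_tgt A h) = l"
proof -
  obtain pt bl where pt: "bij_betw pt {..<v} Pts" and bl: "bij_betw bl {..<v} Bls"
    and A: "\<And>i j. i < v \<Longrightarrow> j < v \<Longrightarrow> A $$ (i, j) = (if (pt i, bl j) \<in> inc then 1 else 0)"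
    and dim: "dim_col A = v"
    using R unfolding representative_def by auto
  have tgt: "S_tgt A i' = {j. j < v \<and> (pt i', bl j) \<in> inc}" if "i' < v" for i'
    using A[OF that] dim by (auto simp: S_tgt_def split: if_splits)
  \<comment> \<open>Columns label blocks, so common targets of \<open>i\<close> and \<open>h\<close>
    are the labels of the blocks through the points \<open>pt i\<close> and
    \<open>pt h\<close>.\<close>
  have "bij_betw bl (S_tgt A i \<inter> S_tgt A h) {b \<in> Bls. (pt i, b) \<in> inc \<and> (pt h, b) \<in> inc}"
    using bl assms(3,4) by (auto simp: tgt bij_betw_def inj_on_def)
  from bij_betw_same_card[OF this]
  have "card (S_tgt A i \<inter> S_tgt A h) = card {b \<in> Bls. (pt i, b) \<in> inc \<and> (pt h, b) \<in> inc}" .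
  moreover have "pt i \<in> Pts" "pt h \<in> Pts" "pt i \<noteq> pt h"
    using pt assms(3-5) by (auto simp: bij_betw_def inj_on_def)
  ultimately show ?thesis
    using D unfolding sbibd_def by simp
qed

section \<open>Parities and tuples\<close>

lemma parity_determines_encodee:
  assumes "finite B" "x \<in> B" and w: "w x \<in> carrier_vec n" "w' x \<in> carrier_vec n"
    and eq: "\<And>y. y \<in> B - {x} \<Longrightarrow> w y = w' y"
    and par: "parity n w B = parity n w' B"
  shows "w x = w' x"
proof (rule eq_vecI)
  show "dim_vec (w x) = dim_vec (w' x)" using w by auto
next
  fix t assume "t < dim_vec (w' x)"
  then have t: "t < n" using w by auto
  have "(\<Sum>y\<in>B. w y $ t) = (\<Sum>y\<in>B. w' y $ t)"
    using arg_cong[OF par, of "\<lambda>u. u $ t"] t by (simp add: parity_def)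
  moreover have "(\<Sum>y\<in>B - {x}. w y $ t) = (\<Sum>y\<in>B - {x}. w' y $ t)"
    using eq by (intro sum.cong) auto
  \<comment> \<open>Addition must stay addition, not become xor, so that the equal remaining sums
    cancel.\<close>
  ultimately show "w x $ t = w' x $ t"
    using assms(1,2) by (simp add: sum.remove del: add_bit_eq_xor)
qed

lemma tuple_subset:
  assumes "legal_placement A v k q pl" "j < v" "B \<in> tuples pl j"
  shows "B \<subseteq> {x \<in> objects pl. j \<in> targets pl x}"
proof -
  have "partition_on {x \<in> objects pl. j \<in> targets pl x} (tuples pl j)"
    using assms(1,2) by (auto simp: legal_placement_def)
  from partition_onD1[OF this] show ?thesis using assms(3) by blast
qed

text \<open>Each encodee of a parity at \<open>j\<close> comes from a source of \<open>j\<close>,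
  and a tuple holds only one object per source. So another lost encodee next to \<open>x\<close>
  points to a different failed node that also has \<open>j\<close> as a target.\<close>

lemma legal_placement_tuple:
  assumes leg: "legal_placement A v k q pl" and dim: "A \<in> carrier_mat v v"
    and x: "x \<in> objects pl" "j \<in> targets pl x"
  obtains B where "j < v" "B \<in> tuples pl j" "x \<in> B" "B \<subseteq> objects pl"
    "\<And>y. y \<in> B - {x} \<Longrightarrow> primary pl y \<noteq> primary pl x \<and> j \<in> S_tgt A (primary pl y)"
proof -
  have obj: "primary pl y < v \<and> targets pl y \<subseteq> S_tgt A (primary pl y)" if "y \<in> objects pl" for y
    using leg that by (auto simp: legal_placement_def)
  then have j: "j < v" using x dim by (auto simp: S_tgt_def)
  then have part: "partition_on {x \<in> objects pl. j \<in> targets pl x} (tuples pl j)"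
    and uniq: "\<forall>B\<in>tuples pl j. \<forall>h\<in>S_src A j. \<exists>!x. x \<in> B \<and> primary pl x = h"
    using leg by (auto simp: legal_placement_def)
  obtain B where B: "B \<in> tuples pl j" "x \<in> B"
    using partition_onD1[OF part] x by blast
  have sub: "B \<subseteq> {x \<in> objects pl. j \<in> targets pl x}"
    using tuple_subset[OF leg j B(1)] .
  have src: "primary pl y \<in> S_src A j" if "y \<in> B" for y
    using sub that obj[of y] dim by (auto simp: S_src_def S_tgt_def)
  show thesis
  proof (rule that)
    show "j < v" "B \<in> tuples pl j" "x \<in> B" "B \<subseteq> objects pl"
      using j B sub by auto
  next
    fix y assume y: "y \<in> B - {x}"
    have "\<exists>!z. z \<in> B \<and> primary pl z = primary pl y"
      using uniq B(1) src[of y] y by blast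
    then have "primary pl y \<noteq> primary pl x" using y B(2) by fastforce
    moreover have "j \<in> S_tgt A (primary pl y)" using sub obj[of y] y by blast
    ultimately show "primary pl y \<noteq> primary pl x \<and> j \<in> S_tgt A (primary pl y)" ..
  qed
qed

section \<open>Private targets and the two rounds\<close>

definition private_targets :: "nat mat \<Rightarrow> nat set \<Rightarrow> nat \<Rightarrow> nat set" where
  "private_targets A F h = {j \<in> F. j \<in> S_tgt A h \<and> (\<forall>h'\<in>F - {h}. j \<notin> S_tgt A h')}"

lemma directly_recoverable_imp_first_round:
  assumes "legal_placement A v k q pl" "directly_recoverable v pl F x"
  shows "first_round v pl F x"
proof -
  obtain j B where B: "(j, B) \<in> alive_parities v pl F" "x \<in> B"
    and alive: "\<not> (\<exists>y\<in>B. y \<noteq> x \<and> y \<in> lost_objects pl F)"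
    using assms(2) by (auto simp: directly_recoverable_def)
  have "B \<subseteq> objects pl"
    using tuple_subset[OF assms(1), of j B] B by (auto simp: alive_parities_def)
  then have "\<forall>y\<in>B - {x}. y \<in> alive_objects pl F"
    using alive by (auto simp: alive_objects_def)
  then show ?thesis
    using assms(2) B by (auto simp: first_round_def directly_recoverable_def)
qed

text \<open>Two assignments agreeing on all alive data are compared round by round: each restoring
  parity has one encodee not yet known to agree, and the others cancel.\<close>

lemma two_rounds_imp_permits_recovery:
  assumes leg: "legal_placement A v k q pl"
    and rounds: "\<And>x. x \<in> lost_objects pl F \<Longrightarrow> first_round v pl F x \<or> second_round v pl F x"
  shows "permits_recovery v n pl F"
  unfolding permits_recovery_def
proof (intro allI impI ballI)
  fix w w' x
  assume w: "\<forall>x\<in>objects pl. w x \<in> carrier_vec n" "\<forall>x\<in>objects pl. w' x \<in> carrier_vec n"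
    and alive: "\<forall>x\<in>alive_objects pl F. w x = w' x"
    and par: "\<forall>(j, B)\<in>alive_parities v pl F. parity n w B = parity n w' B"
    and x: "x \<in> lost_objects pl F"
  have step: "w y = w' y"
    if B: "(j, B) \<in> alive_parities v pl F" "y \<in> B"
      and eq: "\<And>z. z \<in> B - {y} \<Longrightarrow> w z = w' z" for y j B
  proof -
    have sub: "B \<subseteq> objects pl"
      using tuple_subset[OF leg, of j B] B by (auto simp: alive_parities_def)
    show ?thesis
    proof (rule parity_determines_encodee[of B])
      show "finite B" using leg finite_subset[OF sub] by (simp add: legal_placement_def)
      show "parity n w B = parity n w' B" using par B(1) by auto
    qed (use B(2) sub w eq in auto)
  qed
  have first: "w y = w' y" if fr: "first_round v pl F y" for y
  proof -
    obtain j B where "(j, B) \<in> alive_parities v pl F" "y \<in> B"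
      "\<forall>z\<in>B - {y}. z \<in> alive_objects pl F"
      using fr by (auto simp: first_round_def)
    then show ?thesis using step alive by blast
  qed
  show "w x = w' x"
  proof (cases "first_round v pl F x")
    case True
    then show ?thesis by (rule first)
  next
    case False
    then obtain j B where "(j, B) \<in> alive_parities v pl F" "x \<in> B"
      "\<forall>z\<in>B - {x}. z \<in> alive_objects pl F \<or> first_round v pl F z"
      using rounds[OF x] by (auto simp: second_round_def)
    then show ?thesis using step alive first by blast
  qed
qed

section \<open>Bounds on the number of targets\<close>

text \<open>All targets of \<open>x\<close> are targets of its primary node, so each
  \<open>h\<close> in \<open>H\<close> covers at most \<open>l\<close> of them. \<open>H\<close>
  will hold failed nodes that block recovery at alive targets, \<open>P\<close> will hold failed
  targets.\<close>

lemma card_targets_le: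
  assumes D: "sbibd Pts Bls inc v k l" and R: "representative Pts Bls inc v A"
    and leg: "legal_placement A v k q pl" and x: "x \<in> objects pl"
    and H: "H \<subseteq> {..<v} - {primary pl x}" and "finite P"
    and cover: "targets pl x \<subseteq> (\<Union>h\<in>H. S_tgt A h) \<union> P"
  shows "q \<le> l * card H + card P"
proof -
  let ?i = "primary pl x"
  have T: "?i < v" "targets pl x \<subseteq> S_tgt A ?i" "card (targets pl x) = q"
    using leg x by (auto simp: legal_placement_def)
  have fin: "finite H" "finite (S_tgt A ?i)"
    using H finite_subset by (auto simp: S_tgt_def)
  have "q \<le> card ((\<Union>h\<in>H. S_tgt A ?i \<inter> S_tgt A h) \<union> P)"
    unfolding T(3)[symmetric] using T(2) cover fin \<open>finite P\<close> by (intro card_mono) auto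
  also have "\<dots> \<le> card (\<Union>h\<in>H. S_tgt A ?i \<inter> S_tgt A h) + card P"
    by (rule card_Un_le)
  also have "card (\<Union>h\<in>H. S_tgt A ?i \<inter> S_tgt A h) \<le> (\<Sum>h\<in>H. card (S_tgt A ?i \<inter> S_tgt A h))"
    by (rule card_UN_le[OF fin(1)])
  also have "\<dots> = (\<Sum>h\<in>H. l)"
    using H T(1) by (intro sum.cong refl card_common_targets[OF D R]) auto
  finally show ?thesis by (simp add: mult.commute)
qed

text \<open>A target of \<open>x\<close> that is not private is shared with another failed node: at
  an alive target this node owns a second lost encodee. Since \<open>q\<close> is arbitrary here,
  the bound also serves \<open>p = 1\<close>.\<close>

lemma not_directly_recoverable_imp_private_targets:
  assumes D: "sbibd Pts Bls inc v k l" and R: "representative Pts Bls inc v A"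
    and leg: "legal_placement A v k q pl" and F: "F \<subseteq> {..<v}"
    and x: "x \<in> lost_objects pl F" and nd: "\<not> directly_recoverable v pl F x"
  shows "q \<le> l * (card F - 1) + card (private_targets A F (primary pl x))"
proof -
  let ?i = "primary pl x"
  have xo: "x \<in> objects pl" and i: "?i \<in> F" using x by (auto simp: lost_objects_def)
  have dim: "A \<in> carrier_mat v v" using R by (simp add: representative_def)
  have finF: "finite F" using F finite_subset by blast
  have "targets pl x \<subseteq> (\<Union>h\<in>F - {?i}. S_tgt A h) \<union> private_targets A F ?i"
  proof
    fix j assume j: "j \<in> targets pl x"
    obtain B where B: "j < v" "B \<in> tuples pl j" "x \<in> B" "B \<subseteq> objects pl"
      "\<And>y. y \<in> B - {x} \<Longrightarrow> primary pl y \<noteq> ?i \<and> j \<in> S_tgt A (primary pl y)"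
      using legal_placement_tuple[OF leg dim xo j] by metis
    show "j \<in> (\<Union>h\<in>F - {?i}. S_tgt A h) \<union> private_targets A F ?i"
    proof (cases "j \<in> F")
      case True
      moreover have "j \<in> S_tgt A ?i" using leg xo j by (auto simp: legal_placement_def)
      ultimately show ?thesis by (auto simp: private_targets_def)
    next
      case False
      then have "(j, B) \<in> alive_parities v pl F" using B by (simp add: alive_parities_def)
      then have "\<exists>y\<in>B. y \<noteq> x \<and> y \<in> lost_objects pl F"
        using nd x B(3) unfolding directly_recoverable_def by blast
      then obtain y where y: "y \<in> B - {x}" "y \<in> lost_objects pl F" by blast
      from y(2) have "primary pl y \<in> F" by (simp add: lost_objects_def)
      then show ?thesis using B(5)[OF y(1)] by blast
    qed
  qed
  moreover have "finite (private_targets A F ?i)" using finF by (simp add: private_targets_def)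
  ultimately have "q \<le> l * card (F - {?i}) + card (private_targets A F ?i)"
    using F by (intro card_targets_le[OF D R leg xo]) auto
  then show ?thesis using i finF by simp
qed

lemma not_directly_recoverable_imp_second_round:
  assumes D: "sbibd Pts Bls inc v k l" and R: "representative Pts Bls inc v A"
    and leg: "legal_placement A v k q pl"
    and F: "F \<subseteq> {..<v}" "card F \<le> p" and q: "q = l * (p - 1) + 2"
    and x: "x \<in> lost_objects pl F" and nd: "\<not> directly_recoverable v pl F x"
  shows "second_round v pl F x"
proof (rule ccontr)
  assume ns: "\<not> second_round v pl F x"
  let ?i = "primary pl x"
  define H where "H = {h \<in> F - {?i}. \<exists>y\<in>lost_objects pl F.
    primary pl y = h \<and> \<not> directly_recoverable v pl F y}"
  let ?P = "\<Union>h\<in>H. private_targets A F h"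
  have xo: "x \<in> objects pl" and i: "?i \<in> F" using x by (auto simp: lost_objects_def)
  have dim: "A \<in> carrier_mat v v" using R by (simp add: representative_def)
  have finF: "finite F" using F(1) finite_subset by blast
  have HF: "H \<subseteq> F - {?i}" by (auto simp: H_def)
  have finH: "finite H" using HF finF finite_subset by blast
  have finP: "finite (private_targets A F h)" for h using finF by (simp add: private_targets_def)
  have PF: "?P \<subseteq> F" by (auto simp: private_targets_def)
  have "targets pl x \<subseteq> (\<Union>h\<in>H. S_tgt A h) \<union> (F - ?P)"
  proof
    fix j assume j: "j \<in> targets pl x"
    obtain B where B: "j < v" "B \<in> tuples pl j" "x \<in> B" "B \<subseteq> objects pl"
      "\<And>y. y \<in> B - {x} \<Longrightarrow> primary pl y \<noteq> ?i \<and> j \<in> S_tgt A (primary pl y)"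
      using legal_placement_tuple[OF leg dim xo j] by metis
    show "j \<in> (\<Union>h\<in>H. S_tgt A h) \<union> (F - ?P)"
    proof (cases "j \<in> F")
      case True
      moreover have "j \<in> S_tgt A ?i" using leg xo j by (auto simp: legal_placement_def)
      \<comment> \<open>The failed node \<open>?i\<close> has target \<open>j\<close> and is not in
        \<open>H\<close>, so \<open>j\<close> is private to no node of \<open>H\<close>.\<close>
      ultimately show ?thesis using i HF by (auto simp: private_targets_def)
    next
      case False
      then have "(j, B) \<in> alive_parities v pl F" using B by (simp add: alive_parities_def)
      \<comment> \<open>The parity holding \<open>x\<close> at \<open>j\<close> does not help in the
        second round, so some encodee \<open>y\<close> is neither alive nor restored; its primary
        node is then in \<open>H\<close>.\<close>
      then obtain y where y: "y \<in> B - {x}" "y \<notin> alive_objects pl F" "\<not> first_round v pl F y"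
        using ns x B(3) by (auto simp: second_round_def)
      then have lost: "y \<in> lost_objects pl F" using B(4) by (auto simp: alive_objects_def)
      moreover have "\<not> directly_recoverable v pl F y"
        using y(3) directly_recoverable_imp_first_round[OF leg] by blast
      ultimately have "primary pl y \<in> H"
        using B(5)[OF y(1)] by (auto simp: H_def lost_objects_def)
      then show ?thesis using B(5)[OF y(1)] by blast
    qed
  qed
  then have "q \<le> l * card H + card (F - ?P)"
    using HF F finF by (intro card_targets_le[OF D R leg xo]) auto
  moreover have "card (F - ?P) = card F - card ?P"
    using PF finF by (intro card_Diff_subset) (auto intro: finite_subset)
  moreover have "2 * card H \<le> card ?P"
  proof -
    have two: "2 \<le> card (private_targets A F h)" if h: "h \<in> H" for h
    proof -
      obtain y where "y \<in> lost_objects pl F" "primary pl y = h" "\<not> directly_recoverable v pl F y"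
        using h by (auto simp: H_def)
      then have "q \<le> l * (card F - 1) + card (private_targets A F h)"
        using not_directly_recoverable_imp_private_targets[OF D R leg F(1)] by blast
      moreover have "l * (card F - 1) \<le> l * (p - 1)" using F(2) by (intro mult_le_mono) auto
      ultimately show ?thesis using q by linarith
    qed
    have "card ?P = (\<Sum>h\<in>H. card (private_targets A F h))"
      \<comment> \<open>Disjointness: a target private to one node of \<open>H\<close> is no target
        of another, as \<open>H\<close> lies in \<open>F\<close>.\<close>
      using finH finP HF by (intro card_UN_disjoint) (auto simp: private_targets_def)
    also have "\<dots> \<ge> (\<Sum>h\<in>H. 2)" by (intro sum_mono two)
    finally show ?thesis by simp
  qed
  \<comment> \<open>This makes the truncated difference \<open>card F - card ?P\<close> a genuine
    one.\<close>
  moreover have "card ?P \<le> card F" using PF finF by (rule card_mono[rotated])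
  moreover have "card H + 1 \<le> card F"
  proof -
    have "card H \<le> card (F - {?i})" using HF finF by (intro card_mono) auto
    moreover have "card F \<ge> 1" using i finF by (simp add: Suc_le_eq card_gt_0_iff, blast)
    ultimately show ?thesis using i finF by simp
  qed
  moreover have "l \<ge> 1" using D by (simp add: sbibd_def)
  ultimately have bound: "l * (p - 1) + 2 + 2 * card H \<le> l * card H + p"
    using F(2) q by linarith
  \<comment> \<open>With \<open>d\<close> the slack in \<open>card H + 1 \<le> p\<close>,
    \<open>bound\<close> reduces to \<open>l * d + card H + 1 \<le> d\<close>, impossible for
    \<open>l \<ge> 1\<close>.\<close>
  obtain d where d: "p = card H + 1 + d"
    using le_Suc_ex[OF le_trans[OF \<open>card H + 1 \<le> card F\<close> F(2)]] by blast
  have "d \<le> l * d" using \<open>l \<ge> 1\<close> by simp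
  moreover have "l * (p - 1) = l * card H + l * d" using d by (simp add: distrib_left)
  ultimately show False using bound d by linarith
qed

theorem mainTheorem1:
  fixes Pts :: "'pt set" and Bls :: "'bl set" and inc :: "('pt \<times> 'bl) set"
    and v k l p q n :: nat and A :: "nat mat" and pl :: "'x placement"
  assumes "1 \<le> p"
    and "sbibd Pts Bls inc v k l"
    and "representative Pts Bls inc v A"
    and "zero_diagonal A"
    and "q = (if p = 1 then 1 else l * (p - 1) + 2)"
    and "q \<le> k"
    and "legal_placement A v k q pl"
  shows "\<forall>F. F \<subseteq> {..<v} \<and> card F \<le> p \<longrightarrow>
     permits_recovery v n pl F \<and>
     (card F \<le> 2 \<longrightarrow> (\<forall>x\<in>lost_objects pl F. directly_recoverable v pl F x)) \<and>
     (\<forall>x\<in>lost_objects pl F.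
        (directly_recoverable v pl F x \<longrightarrow> first_round v pl F x) \<and>
        (\<not> directly_recoverable v pl F x \<longrightarrow> second_round v pl F x))"
proof (intro allI impI)
  fix F assume asm: "F \<subseteq> {..<v} \<and> card F \<le> p"
  then have F: "F \<subseteq> {..<v}" "card F \<le> p" by auto
  have finF: "finite F" using F(1) finite_subset by blast
  \<comment> \<open>The case \<open>p = 1\<close> is included because \<open>q = 1\<close> then
    falls outside the formula on which the second-round argument rests.\<close>
  have direct: "directly_recoverable v pl F x"
    if x: "x \<in> lost_objects pl F" and small: "p = 1 \<or> card F \<le> 2" for x
  proof (rule ccontr)
    let ?i = "primary pl x"
    assume "\<not> directly_recoverable v pl F x"
    then have le: "q \<le> l * (card F - 1) + card (private_targets A F ?i)"
      using not_directly_recoverable_imp_private_targets[OF assms(2,3,7) F(1) x] by blast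
    have i: "?i \<in> F" using x by (auto simp: lost_objects_def)
    \<comment> \<open>The zero diagonal keeps \<open>?i\<close> from being its own target, which
      leaves at most \<open>card F - 1\<close> private targets.\<close>
    then have "A $$ (?i, ?i) = 0"
      using F(1) assms(3,4) by (auto simp: zero_diagonal_def representative_def)
    then have "private_targets A F ?i \<subseteq> F - {?i}"
      by (auto simp: private_targets_def S_tgt_def)
    then have "card (private_targets A F ?i) \<le> card F - 1"
      using i finF card_mono[of "F - {?i}"] by fastforce
    moreover have "l * (card F - 1) \<le> l * (p - 1)" using F(2) by (intro mult_le_mono) auto
    ultimately have "q \<le> l * (p - 1) + (card F - 1)" using le by linarith
    \<comment> \<open>For \<open>p = 1\<close> the bound gives \<open>q \<le> 0\<close>; otherwise
      \<open>card F \<le> 2\<close> gives \<open>q \<le> l * (p - 1) + 1\<close>, one too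
      few.\<close>
    then show False using small F(2) assms(5) by (cases "p = 1") auto
  qed
  have second: "second_round v pl F x"
    if "x \<in> lost_objects pl F" "\<not> directly_recoverable v pl F x" for x
  proof -
    have "p \<noteq> 1" using direct that by blast
    then have "q = l * (p - 1) + 2" using assms(5) by simp
    then show ?thesis
      using not_directly_recoverable_imp_second_round[OF assms(2,3,7) F] that by blast
  qed
  have first: "first_round v pl F x" if "directly_recoverable v pl F x" for x
    using directly_recoverable_imp_first_round[OF assms(7)] that by blast
  have "permits_recovery v n pl F"
    using first second by (intro two_rounds_imp_permits_recovery[OF assms(7)]) blast
  then show "permits_recovery v n pl F \<and>
     (card F \<le> 2 \<longrightarrow> (\<forall>x\<in>lost_objects pl F. directly_recoverable v pl F x)) \<and>
     (\<forall>x\<in>lost_objects pl F.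
        (directly_recoverable v pl F x \<longrightarrow> first_round v pl F x) \<and>
        (\<not> directly_recoverable v pl F x \<longrightarrow> second_round v pl F x))"
    using direct first second by blast
qed

end
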